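(* Let $G$ be a bipartite graph with bipartition $X\cup Y$. Suppose $U\subseteq Y$ has even cardinality. Then there exist simple graphs $H,K$ on $V(G)$ such that, for every ordered pair $(a,b)\in V(G)\times V(G)$, \[ (A(H)A(K))_{ab}= \begin{cases} 1, & \text{if } a\in X,\ b\in U,\ \text{and } ab\in E(G),\\ 0, & \text{otherwise.} \end{cases} \]
   Context: All graphs are finite, simple and undirected; $A(H)$ is the adjacency matrix of $H$, with rows and columns indexed by $V(G)$ in a common ordering. *)

theory Defs
  imports "Graph_Theory.Pair_Digraph" "Jordan_Normal_Form.Matrix"
begin

text \<open>
  A finite simple undirected graph is a \<open>pair_graph\<close>: a finite, loop-free digraph without
  parallel arcs whose arc relation is symmetric. An undirected edge \<open>ab\<close> is thus the pair of
  arcs \<open>(a, b)\<close> and \<open>(b, a)\<close>. The parts of a bipartition may be empty.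
\<close>

definition bipartition :: "'a pair_pre_digraph \<Rightarrow> 'a set \<Rightarrow> 'a set \<Rightarrow> bool" where
  "bipartition G X Y \<longleftrightarrow>
     pverts G = X \<union> Y \<and> X \<inter> Y = {} \<and> parcs G \<subseteq> X \<times> Y \<union> Y \<times> X"

definition vertex_ordering :: "'a set \<Rightarrow> 'a list \<Rightarrow> bool" where
  "vertex_ordering V vs \<longleftrightarrow> distinct vs \<and> set vs = V"

definition adj_matrix :: "'a list \<Rightarrow> 'a pair_pre_digraph \<Rightarrow> int mat" where
  "adj_matrix vs H =
     mat (length vs) (length vs) (\<lambda>(i, j). if (vs ! i, vs ! j) \<in> parcs H then 1 else 0)"

end

theory Submission
  imports Defs
begin

text \<open>
  Since \<open>card U\<close> is even, \<open>U\<close> carries a fixed-point-free involution \<open>\<sigma>\<close>. Let \<open>K\<close> be the perfect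
  matching \<open>{u, \<sigma> u}\<close> of \<open>U\<close>. Right multiplication by \<open>A(K)\<close> permutes the columns in \<open>U\<close> by
  \<open>\<sigma>\<close> and annihilates all others, so it suffices to let \<open>H\<close> be the graph between \<open>X\<close> and \<open>U\<close> with
  the columns already permuted: \<open>x\<close> is joined to \<open>u\<close> in \<open>H\<close> iff it is joined to \<open>\<sigma> u\<close> in \<open>G\<close>.
  As \<open>\<sigma>\<close> is an involution, the two permutations cancel. The rows outside \<open>X\<close> vanish because
  every edge of \<open>H\<close> has exactly one end in \<open>X\<close>, whereas \<open>K\<close> only meets \<open>U\<close>, which is disjoint
  from \<open>X\<close>.
\<close>

lemma even_card_fixpoint_free_involution:
  assumes "finite U" "even (card U)"
  obtains \<sigma> where "\<And>u. u \<in> U \<Longrightarrow> \<sigma> u \<in> U \<and> \<sigma> u \<noteq> u \<and> \<sigma> (\<sigma> u) = u"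
proof -
  obtain n where "card U = 2 * n"
    using assms(2) by (elim evenE)
  then have "\<exists>\<sigma>. \<forall>u\<in>U. \<sigma> u \<in> U \<and> \<sigma> u \<noteq> u \<and> \<sigma> (\<sigma> u) = u"
    using assms(1)
  proof (induction n arbitrary: U)
    case 0
    then show ?case by auto
  next
    case (Suc n)
    then have "card U = Suc (Suc (2 * n))"
      by simp
    then obtain a W where W: "U = insert a W" "a \<notin> W" "card W = Suc (2 * n)"
      using card_eq_SucD by blast
    obtain b V where "W = insert b V" "b \<notin> V" and card: "card V = 2 * n"
      using card_eq_SucD[OF W(3)] by blast
    with W have V: "U = insert a (insert b V)" "a \<noteq> b" "a \<notin> V" "b \<notin> V"
      by auto
    then have "finite V"
      using Suc.prems(2) by simp
    with card obtain \<sigma> where \<sigma>: "\<forall>u\<in>V. \<sigma> u \<in> V \<and> \<sigma> u \<noteq> u \<and> \<sigma> (\<sigma> u) = u"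
      using Suc.IH by blast
    have "\<forall>u\<in>U. (\<sigma>(a := b, b := a)) u \<in> U \<and> (\<sigma>(a := b, b := a)) u \<noteq> u
        \<and> (\<sigma>(a := b, b := a)) ((\<sigma>(a := b, b := a)) u) = u"
      using \<sigma> V by auto
    then show ?case by blast
  qed
  then show thesis using that by blast
qed

lemma adj_matrix_mult_entry:
  assumes "distinct vs" "i < length vs" "j < length vs"
  shows "(adj_matrix vs H * adj_matrix vs K) $$ (i, j) =
    (\<Sum>c\<in>set vs. of_bool ((vs ! i, c) \<in> parcs H \<and> (c, vs ! j) \<in> parcs K))"
proof -
  have "(adj_matrix vs H * adj_matrix vs K) $$ (i, j) =
      (\<Sum>k<length vs. of_bool ((vs ! i, vs ! k) \<in> parcs H \<and> (vs ! k, vs ! j) \<in> parcs K))"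
    using assms(2,3)
    by (auto simp: adj_matrix_def scalar_prod_def atLeast0LessThan of_bool_def
        simp del: sum_of_bool_eq intro!: sum.cong)
  also have "\<dots> = (\<Sum>c\<in>set vs. of_bool ((vs ! i, c) \<in> parcs H \<and> (c, vs ! j) \<in> parcs K))"
    using bij_betw_nth[OF assms(1) refl refl] by (rule sum.reindex_bij_betw)
  finally show ?thesis .
qed

text \<open>
  An entry counts the walks that take a first step in \<open>H\<close> and a second one in \<open>K\<close>. If the second
  step can only start at \<open>d\<close>, or (when \<open>P\<close> fails) is impossible, there is at most one such walk.
  The condition \<open>P\<close> is separate so that \<open>d\<close> may be a meaningless value where \<open>vs ! j\<close> is isolated.
\<close>

lemma adj_matrix_mult_entry_unique_neighbour:
  assumes "distinct vs" "i < length vs" "j < length vs"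
    and K: "\<And>c. (c, vs ! j) \<in> parcs K \<longleftrightarrow> P \<and> c = d"
    and "P \<Longrightarrow> d \<in> set vs"
  shows "(adj_matrix vs H * adj_matrix vs K) $$ (i, j) = of_bool (P \<and> (vs ! i, d) \<in> parcs H)"
proof -
  have "(adj_matrix vs H * adj_matrix vs K) $$ (i, j) =
      (\<Sum>c\<in>set vs. if c = d then of_bool (P \<and> (vs ! i, d) \<in> parcs H) else 0)"
    unfolding adj_matrix_mult_entry[OF assms(1-3)] K by (intro sum.cong) auto
  also have "\<dots> = of_bool (P \<and> (vs ! i, d) \<in> parcs H)"
    using assms(5) by auto
  finally show ?thesis .
qed

lemma pair_graphI:
  assumes "finite V" "A \<subseteq> V \<times> V" "irrefl A" "sym A"
  shows "pair_graph \<lparr>pverts = V, parcs = A\<rparr>"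
proof
  show "symmetric \<lparr>pverts = V, parcs = A\<rparr>"
    using assms(4) unfolding symmetric_def with_proj_simps by simp
qed (use assms finite_subset[OF assms(2)] in \<open>auto simp: irrefl_def\<close>)

theorem lemma7:
  fixes G :: "'a pair_pre_digraph" and X Y U :: "'a set"
  assumes "pair_graph G"
    and "bipartition G X Y"
    and "U \<subseteq> Y"
    and "even (card U)"
  shows "\<exists>H K. pair_graph H \<and> pverts H = pverts G \<and> pair_graph K \<and> pverts K = pverts G \<and>
    (\<forall>vs. vertex_ordering (pverts G) vs \<longrightarrow>
      (\<forall>i<length vs. \<forall>j<length vs.
        (adj_matrix vs H * adj_matrix vs K) $$ (i, j) =
          (if vs ! i \<in> X \<and> vs ! j \<in> U \<and> (vs ! i, vs ! j) \<in> parcs G then 1 else 0)))"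
proof -
  interpret G: pair_graph G by fact
  have V: "pverts G = X \<union> Y" and disj: "X \<inter> Y = {}"
    using assms(2) by (auto simp: bipartition_def)
  have fin: "finite (pverts G)"
    by simp
  then have "finite U"
    using V assms(3) by (simp add: finite_subset)
  then obtain \<sigma> where \<sigma>: "\<And>u. u \<in> U \<Longrightarrow> \<sigma> u \<in> U \<and> \<sigma> u \<noteq> u \<and> \<sigma> (\<sigma> u) = u"
    using assms(4) even_card_fixpoint_free_involution by blast
  define R where "R = {(x, u). x \<in> X \<and> u \<in> U \<and> (x, \<sigma> u) \<in> parcs G}"
  define M where "M = {(u, v). v \<in> U \<and> u = \<sigma> v}"
  define H where "H = \<lparr>pverts = pverts G, parcs = R \<union> R\<inverse>\<rparr>"
  define K where "K = \<lparr>pverts = pverts G, parcs = M\<rparr>"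
  have H: "pair_graph H"
    unfolding H_def
  proof (rule pair_graphI[OF fin])
    show "R \<union> R\<inverse> \<subseteq> pverts G \<times> pverts G"
      using V assms(3) by (auto simp: R_def)
    show "irrefl (R \<union> R\<inverse>)"
      using disj assms(3) by (auto simp: R_def irrefl_def)
    show "sym (R \<union> R\<inverse>)"
      by (rule sym_Un_converse)
  qed
  have K: "pair_graph K"
    unfolding K_def
  proof (rule pair_graphI[OF fin])
    show "M \<subseteq> pverts G \<times> pverts G"
      using V assms(3) \<sigma> by (auto simp: M_def)
    show "irrefl M"
      using \<sigma> by (force simp: M_def irrefl_def)
    show "sym M"
      using \<sigma> by (auto simp: M_def sym_def)
  qed
  have "(adj_matrix vs H * adj_matrix vs K) $$ (i, j) =
      (if vs ! i \<in> X \<and> vs ! j \<in> U \<and> (vs ! i, vs ! j) \<in> parcs G then 1 else 0)"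
    if vs: "vertex_ordering (pverts G) vs" and ij: "i < length vs" "j < length vs" for vs i j
  proof -
    let ?a = "vs ! i" and ?b = "vs ! j"
    have "(adj_matrix vs H * adj_matrix vs K) $$ (i, j) =
        of_bool (?b \<in> U \<and> (?a, \<sigma> ?b) \<in> parcs H)"
    proof (rule adj_matrix_mult_entry_unique_neighbour)
      show "distinct vs"
        using vs by (simp add: vertex_ordering_def)
      show "\<sigma> ?b \<in> set vs" if "?b \<in> U"
        using that vs V assms(3) \<sigma> by (auto simp: vertex_ordering_def)
    qed (use ij in \<open>auto simp: K_def M_def\<close>)
    also have "?b \<in> U \<and> (?a, \<sigma> ?b) \<in> parcs H \<longleftrightarrow> ?a \<in> X \<and> ?b \<in> U \<and> (?a, ?b) \<in> parcs G"
      \<comment> \<open>The arcs of \<open>R\<inverse>\<close> do not contribute, as they end in \<open>X\<close> whereas \<open>\<sigma>\<close> maps into \<open>U\<close>.\<close>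
      using \<sigma> disj assms(3) by (auto simp: H_def R_def)
    finally show ?thesis
      by (simp add: of_bool_def)
  qed
  then show ?thesis
    using H K by (intro exI[of _ H] exI[of _ K]) (simp add: H_def K_def)
qed

end
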